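(* Let $n\neq 1$ be a positive integer. If $\varphi(2^n-1)\geq 2^{n-1}$, where $\varphi$ is Euler's totient function, then $\ell_{\mathbb{F}_{2^n}}\geq 3(2^n-1)$.
   Context: Let $A$ be a commutative unital ring ($0_A\neq 1_A$). For $a_1,\ldots,a_n\in A$ set $M_n(a_1,\ldots,a_n)=\begin{pmatrix} a_n & -1_A\\ 1_A & 0_A\end{pmatrix}\cdots\begin{pmatrix} a_1 & -1_A\\ 1_A & 0_A\end{pmatrix}$. An $n$-tuple is a $\lambda$-quiddity (solution of $(E_A)$) if $M_n(a_1,\ldots,a_n)=\pm \mathrm{Id}$. For tuples, $(a_1,\ldots,a_n)\oplus(b_1,\ldots,b_m)=(a_1+b_m,a_2,\ldots,a_{n-1},a_n+b_1,b_2,\ldots,b_{m-1})$. Write $(a_1,\ldots,a_n)\sim(b_1,\ldots,b_n)$ if $(b_1,\ldots,b_n)$ is obtained from $(a_1,\ldots,a_n)$ or from $(a_n,\ldots,a_1)$ by a cyclic permutation. A $\lambda$-quiddity $(c_1,\ldots,c_n)$ with $n\geq 3$ is reducible if there exist a $\lambda$-quiddity $(b_1,\ldots,b_l)$ and a tuple $(a_1,\ldots,a_m)$ with $l,m\geq 3$ and $(c_1,\ldots,c_n)\sim(a_1,\ldots,a_m)\oplus(b_1,\ldots,b_l)$; otherwise it is irreducible. When $A$ is finite, there are only finitely many irreducible $\lambda$-quiddities over $A$, and $\ell_A$ denotes their maximal size. $\mathbb{F}_q$ is the field with $q$ elements. *)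

theory Defs
  imports "HOL-Analysis.Cartesian_Space" "HOL-Number_Theory.Totient"
begin

text \<open>
  An \<open>n\<close>-tuple \<open>(a\<^sub>1, \<dots>, a\<^sub>n)\<close> is the list \<open>[a\<^sub>1, \<dots>, a\<^sub>n]\<close>.  The class \<^class>\<open>comm_ring_1\<close>
  includes \<open>0 \<noteq> 1\<close>.
\<close>

definition elem_mat :: "'a::comm_ring_1 \<Rightarrow> 'a^2^2" where
  "elem_mat a = vector [vector [a, -1], vector [1, 0]]"

text \<open>The factors appear in reverse order: \<open>M\<^sub>n(a\<^sub>1, \<dots>, a\<^sub>n)\<close> has the matrix of \<open>a\<^sub>1\<close> on the right.\<close>

primrec M :: "'a::comm_ring_1 list \<Rightarrow> 'a^2^2" where
  "M [] = mat 1"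
| "M (a # as) = M as ** elem_mat a"

definition quiddity :: "'a::comm_ring_1 list \<Rightarrow> bool" where
  "quiddity as \<longleftrightarrow> as \<noteq> [] \<and> (M as = mat 1 \<or> M as = - mat 1)"

text \<open>\<open>(a\<^sub>1 + b\<^sub>m, a\<^sub>2, \<dots>, a\<^bsub>n-1\<^esub>, a\<^sub>n + b\<^sub>1, b\<^sub>2, \<dots>, b\<^bsub>m-1\<^esub>)\<close>, meaningful for lists of length at least 2.\<close>

definition tuple_sum :: "'a::comm_ring_1 list \<Rightarrow> 'a list \<Rightarrow> 'a list" where
  "tuple_sum as bs =
     [hd as + last bs] @ butlast (tl as) @ [last as + hd bs] @ butlast (tl bs)"

definition tuple_equiv :: "'a list \<Rightarrow> 'a list \<Rightarrow> bool" where
  "tuple_equiv as bs \<longleftrightarrow> (\<exists>k. bs = rotate k as \<or> bs = rotate k (rev as))"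

definition reducible :: "'a::comm_ring_1 list \<Rightarrow> bool" where
  "reducible cs \<longleftrightarrow> quiddity cs \<and> length cs \<ge> 3 \<and>
     (\<exists>as bs. quiddity bs \<and> length as \<ge> 3 \<and> length bs \<ge> 3 \<and>
        tuple_equiv cs (tuple_sum as bs))"

definition irreducible_quiddity :: "'a::comm_ring_1 list \<Rightarrow> bool" where
  "irreducible_quiddity cs \<longleftrightarrow> quiddity cs \<and> length cs \<ge> 3 \<and> \<not> reducible cs"

text \<open>
  The number \<open>\<ell>\<^sub>A\<close>.  Over a finite ring there are only finitely many irreducible quiddities, so
  this is a genuine maximum; \<^const>\<open>Max\<close> is unspecified on infinite sets.
\<close>

definition max_irreducible_size :: "'a::{comm_ring_1,finite} itself \<Rightarrow> nat" where
  "max_irreducible_size _ = Max {length cs | cs :: 'a list. irreducible_quiddity cs}"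

end

theory Submission
  imports Defs "HOL-Algebra.Algebraic_Closure_Type" "HOL-Number_Theory.Residues"
begin

text \<open>
  A quiddity corresponds to a closed walk of vectors \<open>v\<^sub>i\<close> in the plane with
  \<open>det (v\<^sub>i\<^sub>+\<^sub>1, v\<^sub>i) = 1\<close>; the continuant of a block of consecutive entries is the determinant of
  the two vectors around it, and a reducible quiddity has a block with continuant \<open>1\<close> or \<open>-1\<close>.
  Over the field with \<open>q = 2\<^sup>n\<close> elements, let \<open>g\<close> be a generator of the multiplicative group and
  repeat the entries \<open>1/g, g, 1/g\<close> exactly \<open>q - 1\<close> times.  The vectors are
  \<open>(g\<^sup>k, 0)\<close>, \<open>(0, g\<^sup>-\<^sup>k)\<close>, \<open>(g\<^sup>k, g\<^sup>-\<^sup>k\<^sup>-\<^sup>1)\<close>.  Since some vector lies on a coordinate axis in every pair of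
  different types, each such determinant is a power of \<open>g\<close> and equals \<open>1\<close> only for neighbours; for
  two vectors of the third type it is \<open>(z + 1/z)/g\<close> with \<open>z\<close> a power of \<open>g\<close>.  So it suffices that
  \<open>g\<close> is not of the form \<open>z + 1/z\<close>.  As \<open>z\<close> and \<open>1/z\<close> give the same value, at most \<open>q/2 - 1\<close>
  nonzero elements have this form, fewer than the \<open>\<phi>(q - 1) \<ge> q/2\<close> generators.
\<close>

unbundle no Formal_Power_Series.fps_syntax

section \<open>Products of two-by-two matrices\<close>

lemma M_append: "M (xs @ ys) = M ys ** M xs"
  by (induction xs) (simp_all add: matrix_mul_assoc)

lemma elem_mat_components [simp]:
  "elem_mat a $ 1 $ 1 = a" "elem_mat a $ 1 $ 2 = -1"
  "elem_mat a $ 2 $ 1 = 1" "elem_mat a $ 2 $ 2 = 0"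
  by (simp_all add: elem_mat_def)

lemma matrix_mult_2_component:
  fixes A B :: "'a::comm_ring_1^2^2"
  shows "(A ** B) $ i $ j = A $ i $ 1 * B $ 1 $ j + A $ i $ 2 * B $ 2 $ j"
  by (simp add: matrix_matrix_mult_def sum_2)

lemma mat_2_eqI:
  fixes A B :: "'a^2^2"
  assumes "A $ 1 $ 1 = B $ 1 $ 1" "A $ 1 $ 2 = B $ 1 $ 2"
    and "A $ 2 $ 1 = B $ 2 $ 1" "A $ 2 $ 2 = B $ 2 $ 2"
  shows "A = B"
  using assms by (simp add: vec_eq_iff forall_2)

lemma mat_1_components [simp]:
  "(mat 1 :: 'a::comm_ring_1^2^2) $ 1 $ 1 = 1" "(mat 1 :: 'a::comm_ring_1^2^2) $ 1 $ 2 = 0"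
  "(mat 1 :: 'a::comm_ring_1^2^2) $ 2 $ 1 = 0" "(mat 1 :: 'a::comm_ring_1^2^2) $ 2 $ 2 = 1"
  by (simp_all add: mat_def)

text \<open>Lets the matrix of a common prefix be cancelled.\<close>

lemma M_right_inverse: "\<exists>B. M xs ** B = mat 1"
proof (induction xs)
  case Nil
  then show ?case by auto
next
  case (Cons a xs)
  then obtain B where B: "M xs ** B = mat 1" by blast
  define C :: "'a^2^2" where "C = vector [vector [0, 1], vector [-1, a]]"
  have "elem_mat a ** C = mat 1"
    by (rule mat_2_eqI) (simp_all add: matrix_mult_2_component C_def)
  then have "M (a # xs) ** (C ** B) = mat 1"
    by (metis B M.simps(2) matrix_mul_assoc matrix_mul_lid)
  then show ?case by blast
qed

subsection \<open>Irreducible quiddities over a finite ring have bounded size\<close>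

lemma reducible_if_quiddity_infix:
  assumes "quiddity (p @ w @ s)" "quiddity w" "length w \<ge> 3" "p @ s \<noteq> []"
  shows "reducible (p @ w @ s)"
proof -
  obtain x w' where w': "w = x # w'" using assms(3) by (cases w) auto
  with assms(3) obtain u y where w: "w = x # u @ [y]" by (cases w' rule: rev_cases) auto
  \<comment> \<open>The outer zeros absorb the end entries of \<open>w\<close>, so the sum is the
    original cycle read from the last entry of \<open>w\<close>.\<close>
  define as where "as = 0 # (s @ p) @ [0]"
  have "tuple_sum as w = y # (s @ p) @ x # u"
    by (simp add: tuple_sum_def as_def w butlast_append)
  also have "\<dots> = rotate (length (p @ x # u)) ((p @ x # u) @ (y # s))"
    by (simp only: rotate_append) simp
  also have "(p @ x # u) @ (y # s) = p @ w @ s" by (simp add: w)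
  finally have "tuple_equiv (p @ w @ s) (tuple_sum as w)"
    unfolding tuple_equiv_def by blast
  moreover have "length as \<ge> 3" using assms(4) by (cases s; cases p) (auto simp: as_def)
  ultimately show ?thesis using assms unfolding reducible_def by auto
qed

text \<open>Two of the prefixes of length divisible by 3 have the same matrix, so the entries between
  them form a quiddity.\<close>

lemma irreducible_quiddity_length_le:
  fixes cs :: "'a::{comm_ring_1,finite} list"
  assumes "irreducible_quiddity cs"
  shows "length cs \<le> 3 * CARD('a^2^2)"
proof (rule ccontr)
  let ?K = "CARD('a^2^2)"
  assume "\<not> ?thesis"
  then have len: "length cs > 3 * ?K" by simp
  have "\<not> inj_on (\<lambda>t. M (take (3 * t) cs)) {..?K}"
  proof
    assume "inj_on (\<lambda>t. M (take (3 * t) cs)) {..?K}"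
    then have "card {..?K} \<le> ?K"
      by (metis card_inj_on_le finite subset_UNIV)
    then show False by simp
  qed
  then obtain i j where ij: "i < j" "j \<le> ?K" "M (take (3 * i) cs) = M (take (3 * j) cs)"
    unfolding inj_on_def by (metis atMost_iff linorder_neqE_nat)
  define p w s where "p = take (3 * i) cs" and "w = take (3 * (j - i)) (drop (3 * i) cs)"
    and "s = drop (3 * j) cs"
  have j: "3 * j = 3 * i + 3 * (j - i)" using ij by simp
  have pw: "take (3 * j) cs = p @ w" unfolding p_def w_def
    by (subst j) (simp only: take_add)
  have cs: "cs = p @ w @ s" unfolding s_def using pw by (metis append_assoc append_take_drop_id)
  have "M w ** M p = M p" using ij(3) pw by (simp add: M_append p_def)
  moreover obtain B where "M p ** B = mat 1" using M_right_inverse by blast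
  ultimately have "M w = mat 1" by (metis matrix_mul_assoc matrix_mul_rid)
  moreover have "length w = 3 * (j - i)" using len ij by (simp add: w_def)
  then have "length w \<ge> 3" using ij by simp
  ultimately have "quiddity w" by (auto simp: quiddity_def)
  \<comment> \<open>The strict length bound leaves an entry after \<open>w\<close>, so
    \<open>w\<close> is a proper infix.\<close>
  moreover have "s \<noteq> []" using len ij by (simp add: s_def)
  ultimately have "reducible cs"
    using assms \<open>length w \<ge> 3\<close> unfolding cs irreducible_quiddity_def
    by (intro reducible_if_quiddity_infix) auto
  then show False using assms by (simp add: irreducible_quiddity_def)
qed

lemma length_le_max_irreducible_size:
  fixes cs :: "'a::{comm_ring_1,finite} list"
  assumes "irreducible_quiddity cs"
  shows "length cs \<le> max_irreducible_size TYPE('a)"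
proof -
  have "{length cs | cs :: 'a list. irreducible_quiddity cs} \<subseteq> {..3 * CARD('a^2^2)}"
    using irreducible_quiddity_length_le by auto
  then have "finite {length cs | cs :: 'a list. irreducible_quiddity cs}"
    using finite_subset by blast
  then show ?thesis unfolding max_irreducible_size_def
    by (rule Max_ge) (use assms in blast)
qed

subsection \<open>Continuants\<close>

lemma M_snoc_Cons_2_2: "M (x # w @ [y]) $ 2 $ 2 = - (M w $ 1 $ 1)"
  by (simp add: M_append matrix_mult_2_component)

text \<open>The sum keeps the inner entries \<open>w\<close> of the quiddity \<open>bs\<close>
  intact, and the lower right entry of \<open>M bs\<close>, which is 1 or -1, is minus the
  continuant of \<open>w\<close>. The remaining block \<open>p\<close> is as long as
  \<open>as\<close>.\<close>

lemma reducible_imp_continuant_unit: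
  assumes "reducible cs"
  obtains p w where "tuple_equiv cs (p @ w)" "length p \<ge> 3" "w \<noteq> []"
    and "M w $ 1 $ 1 = 1 \<or> M w $ 1 $ 1 = - 1"
proof -
  from assms obtain as bs where ab: "quiddity bs" "length as \<ge> 3" "length bs \<ge> 3"
    "tuple_equiv cs (tuple_sum as bs)"
    unfolding reducible_def by blast
  obtain x bs' where bs': "bs = x # bs'" using ab(3) by (cases bs) auto
  with ab(3) obtain w y where bs: "bs = x # w @ [y]" by (cases bs' rule: rev_cases) auto
  have "M bs $ 2 $ 2 = 1 \<or> M bs $ 2 $ 2 = - 1"
    using ab(1) by (auto simp: quiddity_def)
  then have "M w $ 1 $ 1 = 1 \<or> M w $ 1 $ 1 = - 1"
    unfolding bs M_snoc_Cons_2_2 by (metis minus_minus)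
  moreover define p where "p = [hd as + y] @ butlast (tl as) @ [last as + x]"
  have "tuple_sum as bs = p @ w" by (simp add: tuple_sum_def bs p_def)
  moreover have "length p \<ge> 3" "w \<noteq> []" using ab(2,3) by (auto simp: p_def bs)
  ultimately show ?thesis using that ab(4) by metis
qed

text \<open>Each elementary matrix advances the state vector \<open>(x (i + 1), x i)\<close> by one
  step.\<close>

lemma M_recurrence:
  fixes x c :: "nat \<Rightarrow> 'a::comm_ring_1"
  assumes "\<And>i. x (i + 2) = c i * x (i + 1) - x i"
  shows "M (map c [s..<s + L]) $ 1 $ 1 * x (s + 1) + M (map c [s..<s + L]) $ 1 $ 2 * x s
           = x (s + L + 1) \<and>
         M (map c [s..<s + L]) $ 2 $ 1 * x (s + 1) + M (map c [s..<s + L]) $ 2 $ 2 * x s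
           = x (s + L)"
proof (induction L)
  case 0
  then show ?case by simp
next
  case (Suc L)
  let ?X = "M (map c [s..<s + L])"
  have "x (s + Suc L + 1) = c (s + L) * x (s + L + 1) - x (s + L)"
    using assms[of "s + L"] by simp
  also have "\<dots> = c (s + L) * (?X $ 1 $ 1 * x (s + 1) + ?X $ 1 $ 2 * x s) -
      (?X $ 2 $ 1 * x (s + 1) + ?X $ 2 $ 2 * x s)"
    using Suc by simp
  finally show ?case using Suc
    by (simp add: M_append matrix_mult_2_component algebra_simps)
qed

text \<open>Cramer's rule for two solutions with Casorati determinant 1 at \<open>s\<close>: the
  \<open>$ 1 $ 2\<close> entry cancels.\<close>

lemma continuant_eq_det:
  fixes x y c :: "nat \<Rightarrow> 'a::comm_ring_1"
  assumes x: "\<And>i. x (i + 2) = c i * x (i + 1) - x i"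
    and y: "\<And>i. y (i + 2) = c i * y (i + 1) - y i"
    and det: "x (s + 1) * y s - y (s + 1) * x s = 1"
  shows "M (map c [s..<s + L]) $ 1 $ 1 = x (s + L + 1) * y s - y (s + L + 1) * x s"
proof -
  let ?X = "M (map c [s..<s + L])"
  have "x (s + L + 1) * y s - y (s + L + 1) * x s
      = (?X $ 1 $ 1 * x (s + 1) + ?X $ 1 $ 2 * x s) * y s
        - (?X $ 1 $ 1 * y (s + 1) + ?X $ 1 $ 2 * y s) * x s"
    using M_recurrence[OF x, where s = s and L = L] M_recurrence[OF y, where s = s and L = L]
    by simp
  also have "\<dots> = ?X $ 1 $ 1 * (x (s + 1) * y s - y (s + 1) * x s)"
    by (simp add: algebra_simps)
  finally show ?thesis using det by simp
qed

subsection \<open>A suitable generator of the multiplicative group\<close>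

lemma phi'_eq_totient: "phi' n = totient n"
  unfolding phi'_def totient_def totatives_def by (rule arg_cong[where f = card]) auto

text \<open>The multiplicative group is cyclic, and the divisibility condition says that
  \<open>g\<close> has full order.\<close>

lemma card_generators:
  "card {g :: 'a::{field,finite}. g \<noteq> 0 \<and> (\<forall>k. g ^ k = 1 \<longleftrightarrow> (CARD('a) - 1) dvd k)}
     = totient (CARD('a) - 1)"
proof -
  let ?R = "ring_of_type_algebra :: 'a ring"
  let ?G = "Multiplicative_Group.mult_of ?R"
  interpret R: field ?R by (rule field_from_type_algebra)
  interpret G: group ?G by (rule R.field_mult_group)
  have simps: "carrier ?R = UNIV" "\<one>\<^bsub>?R\<^esub> = 1" "\<zero>\<^bsub>?R\<^esub> = 0" "mult ?R = (*)"
    by (simp_all add: ring_of_type_algebra_def)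
  have pow: "x [^]\<^bsub>?G\<^esub> (k::nat) = x ^ k" for x k
    by (induction k) (simp_all add: simps)
  have fin: "finite (carrier ?R)" by simp
  have ord: "Coset.order ?G = CARD('a) - 1"
    using R.order_mult_of[OF fin] by (simp add: Coset.order_def simps)
  have set_eq: "{a \<in> carrier ?G. G.ord a = CARD('a) - 1}
      = {g. g \<noteq> 0 \<and> (\<forall>k. g ^ k = 1 \<longleftrightarrow> (CARD('a) - 1) dvd k)}" (is "?A = ?B")
  proof (rule Set.set_eqI)
    fix a :: 'a
    show "a \<in> ?A \<longleftrightarrow> a \<in> ?B"
    proof (cases "a = 0")
      case False
      then have a: "a \<in> carrier ?G" by (simp add: simps)
      have "G.ord a = CARD('a) - 1 \<longleftrightarrow> (\<forall>k. a ^ k = 1 \<longleftrightarrow> (CARD('a) - 1) dvd k)"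
        unfolding G.ord_unique[OF a] pow Multiplicative_Group.one_mult_of simps ..
      then show ?thesis using False a unfolding mem_Collect_eq by blast
    qed (simp add: simps)
  qed
  \<comment> \<open>Counting the elements of a given order presupposes that one exists; a generator
    supplies it.\<close>
  obtain a where a: "a \<in> carrier ?G" "carrier ?G = {a [^]\<^bsub>?R\<^esub> i | i::nat. i \<in> UNIV}"
    using R.finite_field_mult_group_has_gen[OF fin] by blast
  have "G.ord a \<noteq> 0" using G.ord_ge_1[OF R.finite_mult_of[OF fin] a(1)] by linarith
  from G.generate_pow_nat[OF a(1) this] have "carrier ?G = generate ?G {a}"
    unfolding a(2) Multiplicative_Group.nat_pow_mult_of by (rule sym)
  then have "G.ord a = CARD('a) - 1"
    using G.generate_pow_card[OF a(1)] ord by (simp add: Coset.order_def)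
  then have "card ?A = phi' (CARD('a) - 1)"
    using a(1) by (intro R.num_elems_of_ord_eq_phi'[OF fin]) (auto simp: ord)
  then show ?thesis unfolding set_eq phi'_eq_totient .
qed

lemma card_add_inverse_image:
  assumes "(1 + 1 :: 'a::{field,finite}) = 0"
  shows "2 * card ((\<lambda>z :: 'a. z + inverse z) ` (UNIV - {0, 1})) \<le> CARD('a) - 2"
proof -
  let ?f = "\<lambda>z :: 'a. z + inverse z" and ?U = "UNIV - {0, 1 :: 'a}"
  have minus: "- x = x" for x :: 'a
    using assms by (metis add.inverse_unique distrib_right mult_1 mult_zero_left)
  have fibre: "card {z \<in> ?U. ?f z = y} \<ge> 2" if "y \<in> ?f ` ?U" for y
  proof -
    from that obtain z where z: "z \<noteq> 0" "z \<noteq> 1" "y = ?f z" by auto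
    \<comment> \<open>In characteristic 2 the only square root of 1 is 1, so inversion pairs up the
      elements other than 0 and 1.\<close>
    have "z \<noteq> inverse z"
    proof
      assume "z = inverse z"
      then have "z * z = 1" using z by (metis right_inverse)
      then have "(z - 1) * (z + 1) = 0" by (simp add: algebra_simps)
      then show False using z minus[of 1] by (auto simp: add_eq_0_iff2)
    qed
    then have "card {z, inverse z} = 2" by simp
    moreover have "{z, inverse z} \<subseteq> {z \<in> ?U. ?f z = y}" using z by (auto simp: add.commute)
    ultimately show ?thesis by (metis card_mono finite)
  qed
  have "2 * card (?f ` ?U) = (\<Sum>y\<in>?f ` ?U. 2)" by simp
  also have "\<dots> \<le> (\<Sum>y\<in>?f ` ?U. card {z \<in> ?U. ?f z = y})"
    by (rule sum_mono) (rule fibre)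
  also have "\<dots> = (\<Sum>z\<in>?U. 1)"
    using sum_fun_comp[of ?U "?f ` ?U" ?f "\<lambda>_. 1 :: nat"] by simp
  also have "\<dots> = CARD('a) - 2" by (simp add: card_Diff_subset)
  finally show ?thesis .
qed

lemma exists_generator_not_add_inverse:
  assumes "(1 + 1 :: 'a::{field,finite}) = 0" and "CARD('a) \<le> 2 * totient (CARD('a) - 1)"
  obtains g :: "'a::{field,finite}" where "g \<noteq> 0" "\<And>k. g ^ k = 1 \<longleftrightarrow> (CARD('a) - 1) dvd k"
    and "\<And>z. z \<noteq> 0 \<Longrightarrow> z + inverse z \<noteq> g"
proof -
  define A where "A = {g :: 'a. g \<noteq> 0 \<and> (\<forall>k. g ^ k = 1 \<longleftrightarrow> (CARD('a) - 1) dvd k)}"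
  define I where "I = (\<lambda>z :: 'a. z + inverse z) ` (UNIV - {0, 1})"
  have "CARD('a) > 0" by simp
  then have "card I < card A"
    using card_add_inverse_image[OF assms(1)] card_generators[where 'a = 'a] assms(2)
    unfolding A_def I_def by linarith
  then have "\<not> A \<subseteq> I" by (metis card_mono finite leD)
  then obtain g where g: "g \<in> A" "g \<notin> I" by blast
  show ?thesis
  proof (rule that[of g])
    show "g \<noteq> 0" using g(1) unfolding A_def mem_Collect_eq by (rule conjunct1)
    show "g ^ k = 1 \<longleftrightarrow> (CARD('a) - 1) dvd k" for k
      using g(1) unfolding A_def by (simp only: mem_Collect_eq)
    show "z + inverse z \<noteq> g" if "z \<noteq> 0" for z
    proof (cases "z = 1")
      \<comment> \<open>1 is its own inverse and was left out of \<open>I\<close>; its value is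
        \<open>1 + 1 = 0\<close>.\<close>
      case True
      then show ?thesis using \<open>g \<noteq> 0\<close> assms(1) by simp
    next
      case False
      with that have "z + inverse z \<in> I" unfolding I_def by blast
      with g(2) show ?thesis by metis
    qed
  qed
qed

subsection \<open>The long irreducible quiddity\<close>

definition gen_entry :: "'a::field \<Rightarrow> nat \<Rightarrow> 'a" where
  "gen_entry g i = (if i mod 3 = 1 then g else inverse g)"

text \<open>The vectors of the closed walk are \<open>(gen_x g i, gen_y g i)\<close>.\<close>

definition gen_x :: "'a::field \<Rightarrow> nat \<Rightarrow> 'a" where
  "gen_x g i = (if i mod 3 = 1 then 0 else g ^ (i div 3))"

definition gen_y :: "'a::field \<Rightarrow> nat \<Rightarrow> 'a" where
  "gen_y g i = (if i mod 3 = 0 then 0 else inverse g ^ (Suc i div 3))"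

lemma nat_mod_3_cases:
  fixes i :: nat
  obtains k where "i = 3 * k" | k where "i = 3 * k + 1" | k where "i = 3 * k + 2"
proof -
  have "i = 3 * (i div 3) \<or> i = 3 * (i div 3) + 1 \<or> i = 3 * (i div 3) + 2" by presburger
  then show ?thesis using that by blast
qed

text \<open>The exponent in \<open>gen_y\<close> grows at residue 2, one position before that in
  \<open>gen_x\<close>; hence the \<open>Suc\<close>.\<close>

lemma gen_simps:
  "gen_x g (3 * k) = g ^ k" "gen_x g (3 * k + 1) = 0" "gen_x g (3 * k + 2) = g ^ k"
  "gen_y g (3 * k) = 0" "gen_y g (3 * k + 1) = inverse g ^ k"
  "gen_y g (3 * k + 2) = inverse g ^ (k + 1)"
  "gen_entry g (3 * k) = inverse g" "gen_entry g (3 * k + 1) = g"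
  "gen_entry g (3 * k + 2) = inverse g"
proof -
  have "(3 * k + 2) mod 3 = 2" "Suc (3 * k + 1) div 3 = k" "Suc (3 * k + 2) div 3 = k + 1"
    "(3 * k + 1) mod 3 = 1" "(3 * k + 2) div 3 = k" by presburger+
  then show "gen_x g (3 * k) = g ^ k" "gen_x g (3 * k + 1) = 0" "gen_x g (3 * k + 2) = g ^ k"
    "gen_y g (3 * k) = 0" "gen_y g (3 * k + 1) = inverse g ^ k"
    "gen_y g (3 * k + 2) = inverse g ^ (k + 1)"
    "gen_entry g (3 * k) = inverse g" "gen_entry g (3 * k + 1) = g"
    "gen_entry g (3 * k + 2) = inverse g"
    unfolding gen_x_def gen_y_def gen_entry_def by (simp_all only:) simp_all
qed

text \<open>The signs match only because \<open>- x = x\<close>: at \<open>3 * k\<close> the first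
  recurrence reads \<open>g ^ k = - (g ^ k)\<close>.\<close>

lemma gen_recurrence:
  fixes g :: "'a::field"
  assumes two: "(1 + 1 :: 'a) = 0" and g: "g \<noteq> 0"
  shows "gen_x g (i + 2) = gen_entry g i * gen_x g (i + 1) - gen_x g i" (is ?x)
    and "gen_y g (i + 2) = gen_entry g i * gen_y g (i + 1) - gen_y g i" (is ?y)
    and "gen_x g (i + 1) * gen_y g i - gen_y g (i + 1) * gen_x g i = 1" (is ?d)
proof -
  have minus: "- x = x" for x :: 'a
    using two by (metis add.inverse_unique distrib_right mult_1 mult_zero_left)
  have inv: "inverse g ^ k * g ^ k = 1" "g ^ k * inverse g ^ k = 1" for k
    using g by (simp_all add: power_mult_distrib[symmetric])
  have shift: "3 * k + 1 + 1 = 3 * k + 2" "3 * k + 1 + 2 = 3 * (k + 1)"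
    "3 * k + 2 + 1 = 3 * (k + 1)" "3 * k + 2 + 2 = 3 * (k + 1) + 1" for k :: nat by simp_all
  have "?x \<and> ?y \<and> ?d"
  proof (cases i rule: nat_mod_3_cases)
    case (1 k)
    then show ?thesis using g by (simp only: gen_simps) (simp add: minus inv)
  next
    case (2 k)
    then show ?thesis using g by (simp only: gen_simps shift) (simp add: minus inv)
  next
    case (3 k)
    have "inverse g * g ^ (k+1) - g ^ k = 0" using g by simp
    with 3 show ?thesis using g minus[of "inverse g ^ (k+1)"] inv(2)[of "k + 1"]
      by (simp only: gen_simps shift) (simp add: inv)
  qed
  then show ?x ?y ?d by auto
qed

text \<open>The bounds exclude equal and adjacent positions on the cycle of length
  \<open>3 * m\<close>. Vectors on the same axis have determinant 0. For different types the
  exponent of \<open>g\<close> lies, up to sign, strictly between 0 and \<open>m\<close>.\<close>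

lemma gen_det_neq_1:
  fixes g :: "'a::field"
  assumes two: "(1 + 1 :: 'a) = 0" and g: "g \<noteq> 0"
    and ord: "\<And>k. g ^ k = 1 \<longleftrightarrow> m dvd k"
    and sum: "\<And>z. z \<noteq> 0 \<Longrightarrow> z + inverse z \<noteq> g"
    and ij: "i + 2 \<le> j" "j + 2 \<le> i + 3 * m"
  shows "gen_x g j * gen_y g i - gen_y g j * gen_x g i \<noteq> 1"
proof
  assume *: "gen_x g j * gen_y g i - gen_y g j * gen_x g i = 1"
  have minus: "- x = x" for x :: 'a
    using two by (metis add.inverse_unique distrib_right mult_1 mult_zero_left)
  have quot: "g ^ b * inverse g ^ a = g ^ (b - a)" if "a \<le> b" for a b
    using that g by (simp add: power_diff field_simps)
  have quot': "inverse g ^ b * g ^ a = inverse (g ^ (b - a))" if "a \<le> b" for a b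
    using that g by (simp add: power_diff field_simps)
  have dvd_cases: "d = 0 \<or> m \<le> d" if "m dvd d" for d :: nat
    using that by (cases "d = 0") (auto dest: dvd_imp_le)
  show False
  proof (cases i rule: nat_mod_3_cases; cases j rule: nat_mod_3_cases)
    fix k k' assume e: "i = 3 * k" "j = 3 * k'"
    show False using * unfolding e gen_simps by simp
  next
    fix k k' assume e: "i = 3 * k" "j = 3 * k' + 1"
    have "inverse (g ^ (k' - k)) = 1"
      using * ij quot'[of k k'] unfolding e gen_simps by (simp add: minus)
    then have "m dvd k' - k" using ord by simp
    from dvd_cases[OF this] ij show False unfolding e by arith
  next
    fix k k' assume e: "i = 3 * k" "j = 3 * k' + 2"
    have "inverse (g ^ (k' + 1 - k)) = 1"
      using * ij quot'[of k "k' + 1"] unfolding e gen_simps by (simp add: minus)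
    then have "m dvd k' + 1 - k" using ord by simp
    from dvd_cases[OF this] ij show False unfolding e by arith
  next
    fix k k' assume e: "i = 3 * k + 1" "j = 3 * k'"
    have "g ^ (k' - k) = 1"
      using * ij quot[of k k'] unfolding e gen_simps by simp
    then have "m dvd k' - k" using ord by simp
    from dvd_cases[OF this] ij show False unfolding e by arith
  next
    fix k k' assume e: "i = 3 * k + 1" "j = 3 * k' + 1"
    show False using * unfolding e gen_simps by simp
  next
    fix k k' assume e: "i = 3 * k + 1" "j = 3 * k' + 2"
    have "g ^ (k' - k) = 1"
      using * ij quot[of k k'] unfolding e gen_simps by simp
    then have "m dvd k' - k" using ord by simp
    from dvd_cases[OF this] ij show False unfolding e by arith
  next
    fix k k' assume e: "i = 3 * k + 2" "j = 3 * k'"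
    have "g ^ (k' - (k + 1)) = 1"
      using * ij quot[of "k + 1" k'] unfolding e gen_simps by simp
    then have "m dvd k' - (k + 1)" using ord by simp
    from dvd_cases[OF this] ij show False unfolding e by arith
  next
    fix k k' assume e: "i = 3 * k + 2" "j = 3 * k' + 1"
    have "inverse (g ^ (k' - k)) = 1"
      using * ij quot'[of k k'] unfolding e gen_simps by (simp add: minus)
    then have "m dvd k' - k" using ord by simp
    from dvd_cases[OF this] ij show False unfolding e by arith
  next
    fix k k' assume e: "i = 3 * k + 2" "j = 3 * k' + 2"
    define z where "z = g ^ (k' - k)"
    have k: "k \<le> k'" using ij unfolding e by simp
    have "g ^ k' * inverse g ^ (k + 1) - inverse g ^ (k' + 1) * g ^ k = 1"
      using * unfolding e gen_simps .
    moreover have "g ^ k' * inverse g ^ (k + 1) = z * inverse g"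
      using quot[OF k] by (simp add: z_def mult.assoc)
    moreover have "inverse g ^ (k' + 1) * g ^ k = inverse z * inverse g"
      using quot'[OF k] by (simp add: z_def mult.assoc mult.left_commute)
    ultimately have "z * inverse g - inverse z * inverse g = 1" by (simp only:)
    \<comment> \<open>Characteristic 2 turns the difference into the sum that \<open>g\<close>
      avoids.\<close>
    moreover have "z * inverse g - inverse z * inverse g = (z + - inverse z) * inverse g"
      by (simp add: left_diff_distrib)
    ultimately have "(z + inverse z) * inverse g = 1" unfolding minus by simp
    then have "z + inverse z = g" using g by (simp add: field_simps)
    then show False using sum[of z] g by (simp add: z_def)
  qed
qed

lemma rev_map_gen_entry: "rev (map (gen_entry g) [0..<3 * m]) = map (gen_entry g) [0..<3 * m]"
proof (rule nth_equalityI)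
  fix i assume "i < length (rev (map (gen_entry g) [0..<3 * m]))"
  then have i: "i < 3 * m" by simp
  define d where "d = 3 * m - Suc i"
  have "i + d + 1 = 3 * m" using i by (simp add: d_def)
  \<comment> \<open>Mirror positions add up to 2 modulo 3, so residue 1 is its own mirror
    image.\<close>
  then have "d mod 3 = 1 \<longleftrightarrow> i mod 3 = 1" by presburger
  then show "rev (map (gen_entry g) [0..<3 * m]) ! i = map (gen_entry g) [0..<3 * m] ! i"
    using i by (simp add: rev_nth gen_entry_def d_def)
qed simp

text \<open>Rotations become windows of the infinite periodic sequence, to which the recurrences
  apply.\<close>

lemma rotate_map_gen_entry:
  "rotate k (map (gen_entry g) [0..<3 * m]) = map (gen_entry g) [k..<k + 3 * m]"
proof (rule nth_equalityI)
  fix i assume "i < length (rotate k (map (gen_entry g) [0..<3 * m]))"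
  then have i: "i < 3 * m" by simp
  have "(k + i) mod (3 * m) mod 3 = (k + i) mod 3" by (simp add: mod_mod_cancel)
  then show "rotate k (map (gen_entry g) [0..<3 * m]) ! i
      = map (gen_entry g) [k..<k + 3 * m] ! i"
    using i by (simp add: nth_rotate gen_entry_def)
qed simp

lemma irreducible_quiddity_gen_entry:
  fixes g :: "'a::field"
  assumes two: "(1 + 1 :: 'a) = 0" and g: "g \<noteq> 0"
    and ord: "\<And>k. g ^ k = 1 \<longleftrightarrow> m dvd k"
    and sum: "\<And>z. z \<noteq> 0 \<Longrightarrow> z + inverse z \<noteq> g"
    and "m > 0"
  shows "irreducible_quiddity (map (gen_entry g) [0..<3 * m])" (is "irreducible_quiddity ?cs")
proof -
  note rec = gen_recurrence[OF two g]
  have minus1: "- 1 = (1 :: 'a)" using two by (metis add.inverse_unique)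
  have gm: "g ^ m = 1" "inverse g ^ m = 1" using ord[of m] by (simp_all add: power_inverse)
  have "M ?cs = mat 1"
  proof -
    \<comment> \<open>The walk starts at the standard basis vectors and returns to them after
      \<open>3 * m\<close> steps, which determines all four matrix entries.\<close>
    have 0: "gen_x g 0 = 1" "gen_x g (0 + 1) = 0" "gen_y g 0 = 0" "gen_y g (0 + 1) = 1"
      "gen_x g (0 + 3 * m) = 1" "gen_x g (0 + 3 * m + 1) = 0"
      "gen_y g (0 + 3 * m) = 0" "gen_y g (0 + 3 * m + 1) = 1"
      using gen_simps[of g 0] gen_simps[of g m] gm by simp_all
    show ?thesis
      using M_recurrence[OF rec(1), of 0 "3 * m"] M_recurrence[OF rec(2), of 0 "3 * m"]
      unfolding 0 by (intro mat_2_eqI) simp_all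
  qed
  then have "quiddity ?cs" using \<open>m > 0\<close> by (simp add: quiddity_def)
  moreover have "\<not> reducible ?cs"
  proof
    assume "reducible ?cs"
    then obtain p w where pw: "tuple_equiv ?cs (p @ w)" "length p \<ge> 3" "w \<noteq> []"
      and w: "M w $ 1 $ 1 = 1"
      using minus1 by (metis reducible_imp_continuant_unit)
    obtain k where k: "p @ w = map (gen_entry g) [k..<k + 3 * m]"
      using pw(1) unfolding tuple_equiv_def rev_map_gen_entry rotate_map_gen_entry by blast
    define s L where "s = k + length p" and "L = length w"
    have len: "length p + L = 3 * m" using arg_cong[OF k, of length] by (simp add: L_def)
    have "w = drop (length p) (map (gen_entry g) [k..<k + 3 * m])"
      unfolding k[symmetric] by simp
    also have "\<dots> = map (gen_entry g) [s..<s + L]"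
      using len by (simp add: drop_map s_def add.assoc)
    finally have "gen_x g (s + L + 1) * gen_y g s - gen_y g (s + L + 1) * gen_x g s = 1"
      using w continuant_eq_det[OF rec(1) rec(2) rec(3), of s L] by simp
    moreover have "L > 0" using pw(3) by (simp add: L_def)
    \<comment> \<open>\<open>L > 0\<close> gives the lower bound on \<open>s + L + 1\<close>, and
      \<open>length p \<ge> 3\<close> the upper one.\<close>
    ultimately show False
      using gen_det_neq_1[OF two g ord sum, of s "s + L + 1"] pw(2) len by simp
  qed
  ultimately show ?thesis using \<open>m > 0\<close> by (simp add: irreducible_quiddity_def)
qed

theorem theorem6p14:
  fixes n :: nat
  assumes "n > 0" and "n \<noteq> 1"
    and "CARD('a::{field,finite}) = 2 ^ n"
    and "totient (2 ^ n - 1) \<ge> 2 ^ (n - 1)"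
  shows "max_irreducible_size TYPE('a) \<ge> 3 * (2 ^ n - 1)"
proof -
  \<comment> \<open>This makes \<open>2 ^ n\<close> vanish in the field, hence also 2.\<close>
  have "(of_nat CARD('a) :: 'a) = 0"
    using CHAR_dvd_CARD[where 'a = 'a] by (simp add: of_nat_eq_0_iff_char_dvd)
  then have "(2 :: 'a) = 0" using assms(3) by simp
  then have two: "(1 + 1 :: 'a) = 0" by simp
  have "(2::nat) ^ n = 2 * 2 ^ (n - 1)" using assms(1) by (cases n) auto
  then have "CARD('a) \<le> 2 * totient (CARD('a) - 1)" using assms(3,4) by simp
  then obtain g :: 'a where g: "g \<noteq> 0" "\<And>k. g ^ k = 1 \<longleftrightarrow> (CARD('a) - 1) dvd k"
    "\<And>z. z \<noteq> 0 \<Longrightarrow> z + inverse z \<noteq> g"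
    using exists_generator_not_add_inverse[OF two] by metis
  have "CARD('a) - 1 > 0" using assms(1,3) one_less_power[of "2 :: nat" n] by simp
  from length_le_max_irreducible_size[OF irreducible_quiddity_gen_entry[OF two g this]]
  show ?thesis using assms(3) by simp
qed

end
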